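(* Let $I_1, J_1, I_2, J_2, \ldots$ be nonempty finite intervals in $\mathbb{Z}$ such that: (i) for every positive integer $k$, $\min J_k=\max I_k+1$ and $\min I_{k+1}=\max J_k+1$; (ii) the cardinalities $\# I_k$ form a strictly increasing sequence; (iii) the cardinalities $\# J_k$ form a strictly increasing sequence. Then each of the following sets admits a minimal complement and admits no minimal asymptotic complement in $\mathbb{Z}$: (1) $\bigcup_{k=1}^\infty I_k$; (2) $\mathbb{Z}_{<\min I_1}\cup \bigcup_{k=1}^\infty I_k$; (3) $(\mathbb{Z}_{<\min I_1}\setminus F)\cup \bigcup_{k=1}^\infty I_k$, for any nonempty finite subset $F$ of $\mathbb{Z}$; (4) $\{x\in \mathbb{Z}_{<\min I_1} : x\equiv a \bmod n\}\cup \bigcup_{k=1}^\infty I_k$, for any integers $a,n$ with $n\neq 0$.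
   Context: A nonempty subset $X\subseteq\mathbb{Z}$ is an interval if whenever $x_1\le x_2$ are in $X$, every integer $n$ with $x_1\le n\le x_2$ is in $X$. $\mathbb{Z}_{<x}=\{n\in\mathbb{Z}: n<x\}$. For nonempty $A,B\subseteq\mathbb{Z}$, $A+B=\{a+b: a\in A,b\in B\}$. Given nonempty $W,C\subseteq \mathbb{Z}$: $C$ is a complement to $W$ if $W+C=\mathbb{Z}$; a minimal complement if it is a complement but $C\setminus\{c\}$ is not for every $c\in C$. $C$ is an asymptotic complement to $W$ if $\mathbb{Z}\setminus(W+C)$ is finite; a minimal asymptotic complement if it is an asymptotic complement but $C\setminus\{c\}$ is not for every $c\in C$. *)

theory Defs
  imports Main "HOL-Library.Set_Algebras"
begin

definition int_interval :: "int set \<Rightarrow> bool" where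
  "int_interval X \<longleftrightarrow> X \<noteq> {} \<and>
     (\<forall>x1\<in>X. \<forall>x2\<in>X. \<forall>n. x1 \<le> n \<and> n \<le> x2 \<longrightarrow> n \<in> X)"

text \<open>Here \<open>W + C\<close> is the elementwise sum of sets from \<open>Set_Algebras\<close>.\<close>

definition complement_to :: "int set \<Rightarrow> int set \<Rightarrow> bool" where
  "complement_to W C \<longleftrightarrow> W \<noteq> {} \<and> C \<noteq> {} \<and> W + C = UNIV"

definition minimal_complement_to :: "int set \<Rightarrow> int set \<Rightarrow> bool" where
  "minimal_complement_to W C \<longleftrightarrow>
     complement_to W C \<and> (\<forall>c\<in>C. \<not> complement_to W (C - {c}))"

definition asymptotic_complement_to :: "int set \<Rightarrow> int set \<Rightarrow> bool" where
  "asymptotic_complement_to W C \<longleftrightarrow> W \<noteq> {} \<and> C \<noteq> {} \<and> finite (UNIV - (W + C))"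

definition minimal_asymptotic_complement_to :: "int set \<Rightarrow> int set \<Rightarrow> bool" where
  "minimal_asymptotic_complement_to W C \<longleftrightarrow>
     asymptotic_complement_to W C \<and> (\<forall>c\<in>C. \<not> asymptotic_complement_to W (C - {c}))"

definition min_compl_but_no_min_asymp_compl :: "int set \<Rightarrow> bool" where
  "min_compl_but_no_min_asymp_compl W \<longleftrightarrow>
     (\<exists>C. minimal_complement_to W C) \<and> \<not> (\<exists>C. minimal_asymptotic_complement_to W C)"

end

theory Submission
  imports Defs
begin

text \<open>
  Let \<open>W\<close> be one of the four sets.

  A minimal complement is built greedily, keeping a symmetric integer interval covered. If the next
  point \<open>n\<close> to the right of the interval is not yet covered, cover it by \<open>n - w\<close> where \<open>w\<close> is the
  left end of a block that follows a very long gap of \<open>W\<close>: then the new translate misses the whole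
  current interval. On the left one uses the right ends of blocks. Each chosen translate is
  therefore the only one that ever covers the point for which it was chosen.

  A finite set is never an asymptotic complement, since \<open>W\<close> has arbitrarily long gaps. So an
  asymptotic complement \<open>C\<close> contains three elements \<open>c' < c < c''\<close> in one residue class modulo the
  period of \<open>W\<close> at \<open>-\<infinity>\<close>. Near \<open>-\<infinity>\<close> the translate by \<open>c\<close> is contained in the one by
  \<open>c'\<close>; near \<open>+\<infinity>\<close> the blocks are longer than \<open>c'' - c'\<close>, so each point of the translate by \<open>c\<close>
  lies in the translate by \<open>c'\<close> or by \<open>c''\<close>. Hence \<open>c\<close> can be removed.
\<close>

section \<open>Existence of minimal complements\<close>

text \<open>The witness \<open>u\<close> of \<open>c\<close> lies in \<open>K\<close>, so
  \<open>c\<close> stays irredundant in every enlargement of \<open>C\<close> whose new translates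
  avoid \<open>K\<close>. This makes minimality pass to the limit.\<close>

definition witnessed_cover :: "int set \<Rightarrow> int set \<Rightarrow> int set \<Rightarrow> bool" where
  "witnessed_cover W K C \<longleftrightarrow> K \<subseteq> W + C \<and> (\<forall>c\<in>C. \<exists>u\<in>K. u \<notin> W + (C - {c}))"

text \<open>If \<open>n\<close> is uncovered, add \<open>n - w\<close>. The hypothesis on
  \<open>w\<close> says that its translate misses \<open>K\<close>, so old witnesses survive, and
  \<open>n\<close> itself witnesses \<open>n - w\<close>.\<close>

lemma witnessed_cover_insert:
  assumes C: "witnessed_cover W K C"
    and w: "w \<in> W" "\<And>x. x \<in> K \<Longrightarrow> x - n + w \<notin> W"
  obtains C' where "witnessed_cover W (insert n K) C'" "C \<subseteq> C'" "(W + (C' - C)) \<inter> K = {}"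
proof (cases "n \<in> W + C")
  case True
  show thesis
  proof
    show "witnessed_cover W (insert n K) C"
      using C True by (auto simp: witnessed_cover_def)
  qed (auto elim: set_plus_elim)
next
  case False
  let ?C' = "insert (n - w) C"
  have miss: "x \<notin> W + {n - w}" if "x \<in> K" for x
    using w(2)[OF that] by (auto elim!: set_plus_elim simp: algebra_simps)
  have n: "n \<in> W + ?C'"
    using set_plus_intro[OF w(1), of "n - w" ?C'] by simp
  show thesis
  proof
    have mono: "W + C \<subseteq> W + ?C'" by (rule set_plus_mono2) auto
    have "\<exists>u\<in>insert n K. u \<notin> W + (?C' - {c})" if "c \<in> ?C'" for c
    proof (cases "c = n - w")
      case True
      have "W + (?C' - {c}) \<subseteq> W + C" by (rule set_plus_mono2) (use True in auto)
      with False show ?thesis by blast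
    next
      case neq: False
      with that C obtain u where u: "u \<in> K" "u \<notin> W + (C - {c})"
        by (auto simp: witnessed_cover_def)
      have "u \<notin> W + (?C' - {c})"
      proof
        assume "u \<in> W + (?C' - {c})"
        then obtain v d where d: "u = v + d" "v \<in> W" "d \<in> ?C' - {c}" by (rule set_plus_elim)
        show False
        proof (cases "d = n - w")
          case True
          with d miss[OF u(1)] set_plus_intro[of v W d "{n - w}"] show False by simp
        next
          case False
          with d u(2) set_plus_intro[of v W d "C - {c}"] show False by simp
        qed
      qed
      with u(1) show ?thesis by blast
    qed
    then show "witnessed_cover W (insert n K) ?C'"
      using C n mono unfolding witnessed_cover_def by blast
    have "W + (?C' - C) \<subseteq> W + {n - w}" by (rule set_plus_mono2) auto
    then show "(W + (?C' - C)) \<inter> K = {}" using miss by blast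
  qed auto
qed

lemma minimal_complement_exists:
  fixes W :: "int set"
  assumes left_gap: "\<And>N::int. \<exists>w\<in>W. \<forall>d. 0 < d \<and> d \<le> N \<longrightarrow> w - d \<notin> W"
    and right_gap: "\<And>N::int. \<exists>w\<in>W. \<forall>d. 0 < d \<and> d \<le> N \<longrightarrow> w + d \<notin> W"
  shows "\<exists>C. minimal_complement_to W C"
proof -
  \<comment> \<open>Open ends make \<open>K 0\<close> empty, so the recursion can start from the
    empty set; stage \<open>m\<close> then adds the points \<open>m\<close> and
    \<open>- m\<close>.\<close>
  define K :: "nat \<Rightarrow> int set" where "K m = {- int m<..<int m}" for m
  have "\<exists>f. \<forall>m. witnessed_cover W (K m) (f m) \<and>
      (f m \<subseteq> f (Suc m) \<and> (W + (f (Suc m) - f m)) \<inter> K m = {})"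
  proof (rule dependent_nat_choice)
    show "\<exists>C. witnessed_cover W (K 0) C"
      by (rule exI[of _ "{}"]) (simp add: witnessed_cover_def K_def)
  next
    fix C m assume C: "witnessed_cover W (K m) C"
    \<comment> \<open>The points of \<open>K m\<close>, and later also \<open>m\<close> measured
      from \<open>- m\<close>, lie at distance at most \<open>2 * m\<close> from the point to be
      covered.\<close>
    obtain w where w: "w \<in> W" "\<And>d. 0 < d \<Longrightarrow> d \<le> 2 * int m \<Longrightarrow> w - d \<notin> W"
      using left_gap by blast
    have "x - int m + w \<notin> W" if "x \<in> K m" for x
      using that w(2)[of "int m - x"] by (simp add: K_def algebra_simps)
    then obtain C1 where C1: "witnessed_cover W (insert (int m) (K m)) C1" "C \<subseteq> C1"
      "(W + (C1 - C)) \<inter> K m = {}"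
      using witnessed_cover_insert[OF C w(1)] by metis
    obtain v where v: "v \<in> W" "\<And>d. 0 < d \<Longrightarrow> d \<le> 2 * int m \<Longrightarrow> v + d \<notin> W"
      using right_gap by blast
    have K_Suc: "K (Suc m) = insert (- int m) (insert (int m) (K m))"
      by (auto simp: K_def)
    have "\<exists>C2. witnessed_cover W (K (Suc m)) C2 \<and> C1 \<subseteq> C2 \<and> (W + (C2 - C1)) \<inter> K m = {}"
    \<comment> \<open>For \<open>m = 0\<close> the points \<open>m\<close> and \<open>- m\<close>
      coincide, and the second insertion would need a gap at distance 0.\<close>
    proof (cases "m = 0")
      case True
      then have "K (Suc m) = insert (int m) (K m)" by (auto simp: K_def)
      with C1(1) show ?thesis by (intro exI[of _ C1]) (auto elim: set_plus_elim)
    next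
      case False
      have "x - (- int m) + v \<notin> W" if "x \<in> insert (int m) (K m)" for x
        using that v(2)[of "x + int m"] False by (auto simp: K_def algebra_simps)
      then obtain C2 where "witnessed_cover W (K (Suc m)) C2" "C1 \<subseteq> C2"
        "(W + (C2 - C1)) \<inter> insert (int m) (K m) = {}"
        using witnessed_cover_insert[OF C1(1) v(1)] unfolding K_Suc by metis
      then show ?thesis by blast
    qed
    then obtain C2 where C2: "witnessed_cover W (K (Suc m)) C2" "C1 \<subseteq> C2"
      "(W + (C2 - C1)) \<inter> K m = {}" by blast
    have "(W + (C2 - C)) \<inter> K m = {}"
    proof -
      have "W + (C2 - C) \<subseteq> (W + (C1 - C)) \<union> (W + (C2 - C1))"
        by (auto simp: set_plus_def)
      with C1(3) C2(3) show ?thesis by blast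
    qed
    with C1(2) C2 show "\<exists>C'. witnessed_cover W (K (Suc m)) C' \<and>
        (C \<subseteq> C' \<and> (W + (C' - C)) \<inter> K m = {})"
      by blast
  qed
  then obtain f where cover: "\<And>m. witnessed_cover W (K m) (f m)"
    and f_Suc: "\<And>m. f m \<subseteq> f (Suc m)"
    and new: "\<And>m. (W + (f (Suc m) - f m)) \<inter> K m = {}"
    by blast
  have f_mono: "f i \<subseteq> f j" if "i \<le> j" for i j
    using lift_Suc_mono_le[of f, OF f_Suc that] .
  have new_le: "(W + (f (m + i) - f m)) \<inter> K m = {}" for m i
  proof (induction i)
    case 0
    then show ?case by (auto elim: set_plus_elim)
  next
    case (Suc i)
    have "W + (f (m + Suc i) - f m) \<subseteq>
        (W + (f (m + i) - f m)) \<union> (W + (f (Suc (m + i)) - f (m + i)))"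
      by (auto simp: set_plus_def)
    moreover have "K m \<subseteq> K (m + i)" by (auto simp: K_def)
    ultimately show ?case using Suc new[of "m + i"] by blast
  qed
  define C where "C = (\<Union>m. f m)"
  have "x \<in> W + C" for x
  proof -
    have "x \<in> K (Suc (nat \<bar>x\<bar>))" by (auto simp: K_def)
    with cover[of "Suc (nat \<bar>x\<bar>)"] have "x \<in> W + f (Suc (nat \<bar>x\<bar>))"
      by (auto simp: witnessed_cover_def)
    moreover have "W + f (Suc (nat \<bar>x\<bar>)) \<subseteq> W + C"
      by (rule set_plus_mono2) (auto simp: C_def)
    ultimately show ?thesis by blast
  qed
  then have WC: "W + C = UNIV" by blast
  have "W + (C - {c}) \<noteq> UNIV" if "c \<in> C" for c
  proof -
    from that obtain m where "c \<in> f m" by (auto simp: C_def)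
    with cover[of m] obtain u where u: "u \<in> K m" "u \<notin> W + (f m - {c})"
      by (auto simp: witnessed_cover_def)
    have "u \<notin> W + (C - {c})"
    proof
      assume "u \<in> W + (C - {c})"
      then obtain v d where d: "u = v + d" "v \<in> W" "d \<in> C - {c}" by (rule set_plus_elim)
      then obtain j where "d \<in> f j" by (auto simp: C_def)
      then have "d \<in> f (m + j)" using f_mono[of j "m + j"] by auto
      \<comment> \<open>So \<open>d\<close> was added after stage \<open>m\<close>, and by
        \<open>new_le\<close> its translate cannot reach \<open>u\<close> in
        \<open>K m\<close>.\<close>
      moreover have "d \<notin> f m"
        using u(2) d set_plus_intro[of v W d "f m - {c}"] by auto
      ultimately have "u \<in> W + (f (m + j) - f m)"
        using d set_plus_intro[of v W d "f (m + j) - f m"] by simp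
      with u(1) new_le[of m j] show False by blast
    qed
    then show ?thesis by blast
  qed
  moreover have "W \<noteq> {}" "C \<noteq> {}" using WC by (auto simp: set_plus_def)
  ultimately show ?thesis
    using WC by (auto simp: minimal_complement_to_def complement_to_def)
qed

section \<open>Absence of minimal asymptotic complements\<close>

lemma asymptotic_complement_infinite:
  fixes W :: "int set"
  assumes right_gap: "\<And>N::int. \<exists>w\<in>W. \<forall>d. 0 < d \<and> d \<le> N \<longrightarrow> w + d \<notin> W"
    and C: "asymptotic_complement_to W C"
  shows "infinite C"
proof
  assume fin: "finite C"
  define N where "N = Max (abs ` C)"
  have N: "\<bar>c\<bar> \<le> N" if "c \<in> C" for c
    using fin that by (simp add: N_def)
  let ?U = "UNIV - (W + C)"
  \<comment> \<open>Translates by elements of absolute value at most \<open>N\<close> can fill only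
    \<open>N\<close> places at each end of a gap; \<open>card ?U + 1\<close> uncovered places
    remain, one too many.\<close>
  obtain w where w: "\<And>d. 0 < d \<Longrightarrow> d \<le> 2 * N + int (card ?U) + 1 \<Longrightarrow> w + d \<notin> W"
    using right_gap by blast
  have "{w + N<..w + N + int (card ?U) + 1} \<subseteq> ?U"
  proof
    fix x assume x: "x \<in> {w + N<..w + N + int (card ?U) + 1}"
    have "x \<notin> W + C"
    proof
      assume "x \<in> W + C"
      then obtain v c where v: "x = v + c" "v \<in> W" "c \<in> C" by (rule set_plus_elim)
      have "- N \<le> c" "c \<le> N" using N[OF v(3)] by auto
      with v x have "0 < v - w" "v - w \<le> 2 * N + int (card ?U) + 1" by auto
      with w[of "v - w"] v(2) show False by simp
    qed
    then show "x \<in> ?U" by simp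
  qed
  moreover have "finite ?U" using C by (simp add: asymptotic_complement_to_def)
  ultimately have "card {w + N<..w + N + int (card ?U) + 1} \<le> card ?U"
    by (rule card_mono[rotated])
  then show False by simp
qed

text \<open>By pigeonhole some residue class meets \<open>C\<close> in an infinite set. Divisibility
  is recorded only for \<open>c2 - c1\<close>, since \<open>c3\<close> serves only near plus
  infinity.\<close>

lemma infinite_residue_class_triple:
  fixes C :: "int set" and p :: int
  assumes "infinite C" "p \<noteq> 0"
  obtains c1 c2 c3 where "c1 \<in> C" "c2 \<in> C" "c3 \<in> C" "c1 < c2" "c2 < c3" "p dvd c2 - c1"
proof -
  have "finite (range (\<lambda>c. c mod p))"
  proof (rule finite_subset)
    show "range (\<lambda>c. c mod p) \<subseteq> {- \<bar>p\<bar>..\<bar>p\<bar>}"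
    proof safe
      fix c show "c mod p \<in> {- \<bar>p\<bar>..\<bar>p\<bar>}"
        using abs_mod_less[OF assms(2), of c] by (simp add: abs_less_iff)
    qed
  qed simp
  then have "finite ((\<lambda>c. c mod p) ` C)" by (rule finite_subset[rotated]) auto
  with assms(1) obtain c0 where inf: "infinite {c \<in> C. c mod p = c0 mod p}"
    using pigeonhole_infinite by blast
  define S where "S = {c \<in> C. c mod p = c0 mod p}"
  obtain T where T: "T \<subseteq> S" "card T = 3" "finite T"
    using infinite_arbitrarily_large[OF inf] unfolding S_def by metis
  obtain x y z where "T = {x, y, z}" "x \<noteq> y" "x \<noteq> z" "y \<noteq> z"
    using T(2) by (auto simp: card_3_iff)
  then obtain c1 c2 c3 where "c1 \<in> S" "c2 \<in> S" "c3 \<in> S" "c1 < c2" "c2 < c3"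
    using T(1) by (metis insert_subset linorder_neqE)
  then show thesis
    using that by (auto simp: S_def mod_eq_dvd_iff[symmetric])
qed

lemma no_minimal_asymptotic_complement:
  fixes W :: "int set" and p :: int
  assumes right_gap: "\<And>N::int. \<exists>w\<in>W. \<forall>d. 0 < d \<and> d \<le> N \<longrightarrow> w + d \<notin> W"
    and long_blocks: "\<And>d e::int. \<exists>M. \<forall>x\<in>W. M \<le> x \<longrightarrow> 0 < d \<longrightarrow> 0 < e \<longrightarrow> x - d \<in> W \<or> x + e \<in> W"
    and p: "p \<noteq> 0"
    and periodic: "\<And>d::int. p dvd d \<Longrightarrow> \<exists>M. \<forall>x\<in>W. x < M \<longrightarrow> x + d \<in> W"
  shows "\<not> minimal_asymptotic_complement_to W C"
proof
  assume min: "minimal_asymptotic_complement_to W C"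
  then have C: "asymptotic_complement_to W C"
    by (simp add: minimal_asymptotic_complement_to_def)
  obtain c1 c2 c3 where c: "c1 \<in> C" "c2 \<in> C" "c3 \<in> C" "c1 < c2" "c2 < c3" "p dvd c2 - c1"
    by (rule infinite_residue_class_triple[OF asymptotic_complement_infinite[OF right_gap C] p])
  obtain M1 where M1: "\<And>x. x \<in> W \<Longrightarrow> x < M1 \<Longrightarrow> x + (c2 - c1) \<in> W"
    using periodic[OF c(6)] by blast
  obtain M2 where M2: "\<And>x. x \<in> W \<Longrightarrow> M2 \<le> x \<Longrightarrow> x - (c3 - c2) \<in> W \<or> x + (c2 - c1) \<in> W"
    using long_blocks[of "c3 - c2" "c2 - c1"] c(4,5) by auto
  \<comment> \<open>Removing \<open>c2\<close> can uncover \<open>x\<close> only if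
    \<open>x - c2\<close> is in the bounded window where neither periodicity nor block length
    helps.\<close>
  have "UNIV - (W + (C - {c2})) \<subseteq> (UNIV - (W + C)) \<union> {M1 + c2..M2 + c2}"
  proof
    fix x assume x: "x \<in> UNIV - (W + (C - {c2}))"
    have not_W: "x - c' \<notin> W" if "c' \<in> C" "c' \<noteq> c2" for c'
      using x that set_plus_intro[of "x - c'" W c' "C - {c2}"] by auto
    \<comment> \<open>These are \<open>x - c1\<close> and \<open>x - c3\<close>, written as the
      shifts of \<open>x - c2\<close> occurring in \<open>M1\<close> and \<open>M2\<close>.\<close>
    have n1: "x - c2 + (c2 - c1) \<notin> W" and n3: "x - c2 - (c3 - c2) \<notin> W"
      using not_W[of c1] not_W[of c3] c by auto
    show "x \<in> (UNIV - (W + C)) \<union> {M1 + c2..M2 + c2}"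
    proof (cases "x - c2 \<in> W")
      case True
      with M1[OF True] M2[OF True] n1 n3 show ?thesis by force
    next
      case False
      then have "x \<notin> W + C" using not_W by (metis add_diff_cancel_right' set_plus_elim)
      then show ?thesis by simp
    qed
  qed
  moreover have "finite ((UNIV - (W + C)) \<union> {M1 + c2..M2 + c2})"
    using C by (simp add: asymptotic_complement_to_def)
  ultimately have "finite (UNIV - (W + (C - {c2})))" by (rule finite_subset)
  moreover have "C - {c2} \<noteq> {}" using c by auto
  ultimately have "asymptotic_complement_to W (C - {c2})"
    using C by (simp add: asymptotic_complement_to_def)
  with min c(2) show False by (simp add: minimal_asymptotic_complement_to_def)
qed

section \<open>Unions of growing blocks separated by growing gaps\<close>

text \<open>Blocks are numbered from \<open>1\<close>; \<open>a 0\<close> and \<open>b 0\<close> are junk.\<close>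

locale growing_blocks =
  fixes a b :: "nat \<Rightarrow> int"
  assumes block_length: "k \<ge> 1 \<Longrightarrow> a k + int k \<le> b k + 1"
    and gap_length: "k \<ge> 1 \<Longrightarrow> b k + int k < a (Suc k)"
begin

definition blocks :: "int set" where
  "blocks = (\<Union>k\<in>{1..}. {a k..b k})"

lemma start_less_Suc: "k \<ge> 1 \<Longrightarrow> a k < a (Suc k)"
  using block_length[of k] gap_length[of k] by linarith

lemma start_mono: "i \<le> j \<Longrightarrow> 1 \<le> i \<Longrightarrow> a i \<le> a j"
proof (induction j rule: dec_induct)
  case (step n)
  then show ?case using start_less_Suc[of n] by linarith
qed simp

lemma blocks_ge:
  assumes "x \<in> blocks"
  shows "a 1 \<le> x"
proof -
  from assms obtain k where "1 \<le> k" "a k \<le> x" by (auto simp: blocks_def)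
  with start_mono[of 1 k] show ?thesis by simp
qed

lemma gap_disjoint:
  assumes k: "k \<ge> 1" and x: "b k < x" "x < a (Suc k)"
  shows "x \<notin> blocks"
proof
  assume "x \<in> blocks"
  then obtain j where j: "1 \<le> j" "a j \<le> x" "x \<le> b j" by (auto simp: blocks_def)
  have "j \<le> k"
  proof (rule ccontr)
    assume "\<not> j \<le> k"
    then show False using start_mono[of "Suc k" j] j x by simp
  qed
  moreover have "j \<noteq> k" using j x by auto
  ultimately have "a (Suc j) \<le> a k" using start_mono[of "Suc j" k] by simp
  then show False
    using gap_length[OF j(1)] block_length[OF k] j x k by linarith
qed

text \<open>The four sets of the theorem differ only in the part \<open>L\<close> to the left of the
  first block.\<close>

context
  fixes L :: "int set"
  assumes L: "L \<subseteq> {..<a 1}"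
begin

lemma gap_disjoint_Un:
  assumes "k \<ge> 1" "b k < x" "x < a (Suc k)"
  shows "x \<notin> L \<union> blocks"
proof -
  have "a 1 \<le> x" using start_mono[of 1 k] block_length[of k] assms by linarith
  with L gap_disjoint[OF assms] show ?thesis by auto
qed

lemma right_gap: "\<exists>w\<in>L \<union> blocks. \<forall>d. 0 < d \<and> d \<le> N \<longrightarrow> w + d \<notin> L \<union> blocks"
proof -
  define k where "k = Suc (nat N)"
  have "1 \<le> k" by (simp add: k_def)
  moreover have "a k \<le> b k" using block_length[OF \<open>1 \<le> k\<close>] \<open>1 \<le> k\<close> by linarith
  ultimately have "b k \<in> L \<union> blocks" by (auto simp: blocks_def)
  moreover have "b k + d \<notin> L \<union> blocks" if "0 < d" "d \<le> N" for d
    using gap_disjoint_Un[of k "b k + d"] gap_length[of k] that by (simp add: k_def)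
  ultimately show ?thesis by blast
qed

lemma left_gap: "\<exists>w\<in>L \<union> blocks. \<forall>d. 0 < d \<and> d \<le> N \<longrightarrow> w - d \<notin> L \<union> blocks"
proof -
  define k where "k = Suc (nat N)"
  have "a (Suc k) \<in> L \<union> blocks"
    using block_length[of "Suc k"] by (force simp: blocks_def)
  moreover have "a (Suc k) - d \<notin> L \<union> blocks" if "0 < d" "d \<le> N" for d
    using gap_disjoint_Un[of k "a (Suc k) - d"] gap_length[of k] that by (simp add: k_def)
  ultimately show ?thesis by blast
qed

lemma long_blocks:
  "\<exists>M. \<forall>x\<in>L \<union> blocks. M \<le> x \<longrightarrow> 0 < d \<longrightarrow> 0 < e \<longrightarrow> x - d \<in> L \<union> blocks \<or> x + e \<in> L \<union> blocks"
proof (intro exI ballI impI)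
  \<comment> \<open>The bound \<open>M\<close> is \<open>a K\<close>: from there on, blocks have
    more than \<open>d + e\<close> elements, so no point is both within \<open>d\<close> of the left
    end and within \<open>e\<close> of the right end.\<close>
  define K where "K = Suc (nat (d + e))"
  fix x assume x: "x \<in> L \<union> blocks" and "a K \<le> x" and pos: "0 < d" "0 < e"
  moreover have "a 1 \<le> a K" using start_mono[of 1 K] by (simp add: K_def)
  ultimately have "x \<in> blocks" using L by auto
  then obtain k where k: "1 \<le> k" "a k \<le> x" "x \<le> b k" by (auto simp: blocks_def)
  have "K \<le> k"
  proof (rule ccontr)
    assume "\<not> K \<le> k"
    then show False
      using start_mono[of "Suc k" K] gap_length[of k] k \<open>a K \<le> x\<close> by simp
  qed
  then have "d + e \<le> int k" by (simp add: K_def)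
  with block_length[OF k(1)] k(2,3) pos have "x - d \<in> {a k..b k} \<or> x + e \<in> {a k..b k}"
    by auto
  with k(1) show "x - d \<in> L \<union> blocks \<or> x + e \<in> L \<union> blocks"
    by (auto simp: blocks_def)
qed

lemma min_compl_but_no_min_asymp_compl_blocks:
  fixes p :: int
  assumes p: "p \<noteq> 0"
    and periodic: "\<And>d::int. p dvd d \<Longrightarrow> \<exists>M. \<forall>x\<in>L. x < M \<longrightarrow> x + d \<in> L"
  shows "min_compl_but_no_min_asymp_compl (L \<union> blocks)"
proof -
  have "\<exists>M. \<forall>x\<in>L \<union> blocks. x < M \<longrightarrow> x + d \<in> L \<union> blocks" if d: "p dvd d" for d
  proof -
    obtain M where "\<forall>x\<in>L. x < M \<longrightarrow> x + d \<in> L" using periodic[OF d] by blast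
    then show ?thesis
      \<comment> \<open>Below \<open>a 1\<close> the union consists of \<open>L\<close>
        alone.\<close>
      using blocks_ge by (intro exI[of _ "min M (a 1)"]) force
  qed
  then show ?thesis
    using minimal_complement_exists[OF left_gap right_gap]
      no_minimal_asymptotic_complement[OF right_gap long_blocks p]
    unfolding min_compl_but_no_min_asymp_compl_def by blast
qed

end

end

section \<open>Finite intervals, and application to the four sets\<close>

lemma finite_int_interval_eq:
  assumes "int_interval X" "finite X"
  shows "X = {Min X..Max X}"
proof
  have "Min X \<in> X" "Max X \<in> X" using assms by (simp_all add: int_interval_def)
  then show "{Min X..Max X} \<subseteq> X"
    using assms(1) unfolding int_interval_def by (meson atLeastAtMost_iff subsetI)
  show "X \<subseteq> {Min X..Max X}" using assms(2) by (simp add: subset_iff)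
qed

lemma card_finite_int_interval:
  assumes "int_interval X" "finite X"
  shows "int (card X) = Max X - Min X + 1"
proof -
  have "X \<noteq> {}" using assms(1) by (simp add: int_interval_def)
  then have "Min X \<le> Max X" using assms(2) by simp
  then show ?thesis by (subst finite_int_interval_eq[OF assms]) simp
qed

lemma strict_mono_on_ge_index:
  fixes f :: "nat \<Rightarrow> nat"
  assumes "strict_mono_on {1..} f" "0 < f 1" "1 \<le> k"
  shows "k \<le> f k"
  using assms(3)
proof (induction k rule: dec_induct)
  case base
  then show ?case using assms(2) by simp
next
  case (step n)
  then show ?case using strict_mono_onD[OF assms(1), of n "Suc n"] by simp
qed

theorem theoremC:
  fixes I J :: "nat \<Rightarrow> int set"
  assumes "\<And>k. k \<ge> 1 \<Longrightarrow> int_interval (I k) \<and> finite (I k)"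
    and "\<And>k. k \<ge> 1 \<Longrightarrow> int_interval (J k) \<and> finite (J k)"
    and "\<And>k. k \<ge> 1 \<Longrightarrow> Min (J k) = Max (I k) + 1 \<and> Min (I (k + 1)) = Max (J k) + 1"
    and "strict_mono_on {1..} (\<lambda>k. card (I k))"
    and "strict_mono_on {1..} (\<lambda>k. card (J k))"
  shows "min_compl_but_no_min_asymp_compl (\<Union>k\<in>{1..}. I k)
    \<and> min_compl_but_no_min_asymp_compl ({..<Min (I 1)} \<union> (\<Union>k\<in>{1..}. I k))
    \<and> (\<forall>F::int set. F \<noteq> {} \<and> finite F \<longrightarrow>
         min_compl_but_no_min_asymp_compl (({..<Min (I 1)} - F) \<union> (\<Union>k\<in>{1..}. I k)))
    \<and> (\<forall>a n::int. n \<noteq> 0 \<longrightarrow>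
         min_compl_but_no_min_asymp_compl
           ({x \<in> {..<Min (I 1)}. x mod n = a mod n} \<union> (\<Union>k\<in>{1..}. I k)))"
proof -
  have card_I: "int (card (I k)) = Max (I k) - Min (I k) + 1" and
       card_J: "int (card (J k)) = Max (J k) - Min (J k) + 1" if "k \<ge> 1" for k
    using that assms(1,2) card_finite_int_interval by blast+
  have pos: "0 < card (I 1)" "0 < card (J 1)"
    using assms(1,2)[of 1] by (auto simp: card_gt_0_iff int_interval_def)
  \<comment> \<open>Strictly increasing positive cardinalities have \<open>k\<close>-th term at
    least \<open>k\<close>; \<open>J k\<close> is exactly the gap after \<open>I k\<close>.\<close>
  interpret growing_blocks "\<lambda>k. Min (I k)" "\<lambda>k. Max (I k)"
  proof
    fix k :: nat assume k: "k \<ge> 1"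
    show "Min (I k) + int k \<le> Max (I k) + 1"
      using strict_mono_on_ge_index[OF assms(4) pos(1) k] card_I[OF k] by linarith
    show "Max (I k) + int k < Min (I (Suc k))"
      using strict_mono_on_ge_index[OF assms(5) pos(2) k] card_J[OF k] assms(3)[OF k] by simp
  qed
  have blocks: "(\<Union>k\<in>{1..}. I k) = blocks"
    using assms(1) finite_int_interval_eq unfolding blocks_def by (intro SUP_cong) auto
  have "min_compl_but_no_min_asymp_compl blocks"
    using min_compl_but_no_min_asymp_compl_blocks[of "{}" 1] by simp
  \<comment> \<open>Allowing \<open>F\<close> to be empty also yields the full half-line. To the
    left of \<open>F\<close> the set is a half-line, so every shift \<open>d\<close> is eventually
    harmless and period 1 works.\<close>
  moreover have cofinite: "min_compl_but_no_min_asymp_compl (({..<Min (I 1)} - F) \<union> blocks)"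
    if F: "finite F" for F
  proof (rule min_compl_but_no_min_asymp_compl_blocks[of _ 1])
    fix d :: int
    obtain l where l: "\<And>x. x \<in> F \<Longrightarrow> l \<le> x"
      using bdd_below_finite[OF F] by (auto simp: bdd_below_def)
    have "x + d \<in> {..<Min (I 1)} - F" if "x < min l (Min (I 1)) - d" for x
      using that l[of "x + d"] by auto
    then show "\<exists>M. \<forall>x\<in>{..<Min (I 1)} - F. x < M \<longrightarrow> x + d \<in> {..<Min (I 1)} - F"
      by blast
  qed auto
  moreover have "min_compl_but_no_min_asymp_compl ({..<Min (I 1)} \<union> blocks)"
    using cofinite[of "{}"] by simp
  moreover have "min_compl_but_no_min_asymp_compl
      ({x \<in> {..<Min (I 1)}. x mod n = a mod n} \<union> blocks)" if n: "n \<noteq> 0" for a n :: int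
  proof (rule min_compl_but_no_min_asymp_compl_blocks[OF _ n])
    fix d :: int assume "n dvd d"
    then have "(x + d) mod n = x mod n" for x
      by (metis add.right_neutral dvd_imp_mod_0 mod_add_right_eq)
    then show "\<exists>M. \<forall>x\<in>{x \<in> {..<Min (I 1)}. x mod n = a mod n}. x < M \<longrightarrow>
        x + d \<in> {x \<in> {..<Min (I 1)}. x mod n = a mod n}"
      \<comment> \<open>This bound keeps \<open>x + d\<close> to the left of the first
        block.\<close>
      by (intro exI[of _ "Min (I 1) - d"]) auto
  qed auto
  ultimately show ?thesis unfolding blocks by blast
qed

end
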